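(* Let $V$ be a finite set, let $\Sigma$ be the set of all mappings from $V$ to itself, and let $\mu$ be a probability law on $\Sigma$ such that the directed graph induced by $\mu$ is of constant outdegree, strongly-connected and aperiodic. Let $\{X,N\}$ be a $\mu$-random walk (it is stationary) and let $\lambda$ be the common law of the $X_k$, $k\in\mathbb{Z}$, i.e. the unique probability law on $V$ with $\mu*\lambda=\lambda$. Suppose that $\mathrm{Supp}(\mu)$ is non-synchronizing. Let $s$ be a word in $\mathrm{Supp}(\mu)$ such that $\langle s\rangle V$ is an F-clique, write $\langle s\rangle V=\{\hat x_1,\ldots,\hat x_{\hat m}\}$ with distinct elements, where $\hat m=\min\{\sharp(\langle s'\rangle V): s' \text{ is a word in } \mathrm{Supp}(\mu)\}$, and set $$V_i=\{x\in V:\langle s\rangle x=\hat x_i\},\quad i=1,\ldots,\hat m .$$ Then $$\lambda(V_1)=\cdots=\lambda(V_{\hat m})=\frac1{\hat m}.$$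
   Context: $\Sigma$ is a semigroup under composition, acting on $V$. For a probability law $\mu$ on $\Sigma$, $\mathrm{Supp}(\mu)=\{\sigma:\mu(\sigma)>0\}$. The directed graph induced by $\mu$ is $(V,A)$ with $A(y,x)=\#\{\sigma\in\mathrm{Supp}(\mu):\sigma x=y\}$. It is of constant outdegree if $\sum_yA(y,x)$ does not depend on $x$ (automatic here); strongly-connected if for all $y,x\in V$ there is $n\ge1$ with $A^n(y,x)\ge1$; aperiodic if $\gcd\{n\ge1:A^n(x,x)\ge1\}=1$ for all $x\in V$. A $\mu$-random walk is a pair $\{X,N\}$ of processes $(X_k)_{k\in\mathbb{Z}}$ in $V$ and $(N_k)_{k\in\mathbb{Z}}$ in $\Sigma$ on a common probability space such that $N_k$ is independent of $\sigma(X_j,N_j:j\le k-1)$ for each $k$, $(N_k)$ is i.i.d. with law $\mu$, and $X_k=N_kX_{k-1}$ a.s. for each $k\in\mathbb{Z}$. If the directed graph induced by $\mu$ is of constant outdegree, strongly-connected and aperiodic, then a $\mu$-random walk exists, is unique in law and stationary, and its common one-dimensional law $\lambda$ is the unique probability law on $V$ with $\mu*\lambda=\lambda$, where $(\mu*\lambda)(y)=\sum_{\sigma\in\Sigma}\mu(\sigma)\sum_{x\in V}\lambda(x)1_{\{\sigma x=y\}}$. A word in $\mathrm{Supp}(\mu)$ is a finite sequence $s=(\sigma_p,\ldots,\sigma_1)$ of elements of $\mathrm{Supp}(\mu)$, and $\langle s\rangle=\sigma_p\cdots\sigma_1$. $\mathrm{Supp}(\mu)$ is synchronizing if $\langle s\rangle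 V$ is a singleton for some word $s$; non-synchronizing otherwise. A subset $V_0\subset V$ is synchronizing if $\langle s\rangle V_0$ is a singleton for some word $s$ in $\mathrm{Supp}(\mu)$; $V_0$ is a deadlock if no pair of distinct elements of $V_0$ is synchronizing; $V_0$ is an F-clique if it is a deadlock and $V_0=\langle s\rangle V$ for some word $s$ in $\mathrm{Supp}(\mu)$. Every F-clique has exactly $\hat m$ elements, and F-cliques exist. $\sharp(\cdot)$ denotes cardinality. *)

theory Defs
  imports "HOL-Probability.Probability"
begin

text \<open>
  The finite set \<open>V\<close> is the finite type \<open>'v\<close>, and the semigroup of all mappings from
  \<open>V\<close> to itself is the (finite) type \<open>'v \<Rightarrow> 'v\<close> under composition. A probability law on either
  of them is a \<open>pmf\<close>, so that the support of \<open>\<mu>\<close> is \<open>set_pmf \<mu>\<close>.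
\<close>

subsection \<open>The directed graph induced by a law\<close>

text \<open>Row \<open>y\<close>, column \<open>x\<close>: the number of edges \<^emph>\<open>from\<close> \<open>x\<close> \<^emph>\<open>to\<close> \<open>y\<close>.\<close>

definition adj :: "('v::finite \<Rightarrow> 'v) pmf \<Rightarrow> nat^'v^'v" where
  "adj \<mu> = (\<chi> y x. card {\<sigma> \<in> set_pmf \<mu>. \<sigma> x = y})"

text \<open>
  Powers for the matrix product: the overloaded \<open>(*)\<close> on \<open>nat^'v^'v\<close> is entrywise.
\<close>

primrec matrix_pow :: "nat^'v^'v \<Rightarrow> nat \<Rightarrow> nat^'v::finite^'v" where
  "matrix_pow A 0 = mat 1"
| "matrix_pow A (Suc n) = A ** matrix_pow A n"

definition constant_outdegree :: "nat^'v^'v::finite \<Rightarrow> bool" where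
  "constant_outdegree A \<longleftrightarrow> (\<forall>x x'. (\<Sum>y\<in>UNIV. A $ y $ x) = (\<Sum>y\<in>UNIV. A $ y $ x'))"

definition strongly_connected :: "nat^'v^'v::finite \<Rightarrow> bool" where
  "strongly_connected A \<longleftrightarrow> (\<forall>y x. \<exists>n\<ge>1. matrix_pow A n $ y $ x \<ge> 1)"

definition aperiodic :: "nat^'v^'v::finite \<Rightarrow> bool" where
  "aperiodic A \<longleftrightarrow> (\<forall>x. Gcd {n. n \<ge> 1 \<and> matrix_pow A n $ x $ x \<ge> 1} = 1)"

subsection \<open>Random walks\<close>

text \<open>
  The sigma-algebra generated by \<open>X j, N j\<close> for \<open>j \<le> k - 1\<close> is spelled out via \<open>sigma_sets\<close>;
  every subset of the finite types \<open>'v\<close> and \<open>'v \<Rightarrow> 'v\<close> is measurable.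
\<close>

locale random_walk = prob_space M
  for \<mu> :: "('v::finite \<Rightarrow> 'v) pmf" and M :: "'w measure"
    and X :: "int \<Rightarrow> 'w \<Rightarrow> 'v" and N :: "int \<Rightarrow> 'w \<Rightarrow> ('v \<Rightarrow> 'v)" +
  assumes X_measurable: "\<And>k. X k \<in> measurable M (count_space UNIV)"
    and N_measurable: "\<And>k. N k \<in> measurable M (count_space UNIV)"
    and N_indep_past: "\<And>k. indep_set
          {N k -` B \<inter> space M | B. True}
          (sigma_sets (space M)
             (\<Union>j\<in>{..k - 1}. {X j -` C \<inter> space M | C. True} \<union> {N j -` B \<inter> space M | B. True}))"
    and N_indep: "indep_vars (\<lambda>_. count_space UNIV) N UNIV"
    and N_law: "\<And>k. distr M (count_space UNIV) (N k) = measure_pmf \<mu>"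
    and step: "\<And>k. AE \<omega> in M. X k \<omega> = N k \<omega> (X (k - 1) \<omega>)"

subsection \<open>Words, synchronization, and F-cliques\<close>

text \<open>
  A word \<open>(\<sigma>\<^sub>p, \<dots>, \<sigma>\<^sub>1)\<close> is the list \<open>[\<sigma>\<^sub>p, \<dots>, \<sigma>\<^sub>1]\<close>, so the last entry acts first.
  The empty word is allowed, with value \<open>id\<close>.
\<close>

definition word :: "('v \<Rightarrow> 'v) pmf \<Rightarrow> ('v \<Rightarrow> 'v) list \<Rightarrow> bool" where
  "word \<mu> s \<longleftrightarrow> set s \<subseteq> set_pmf \<mu>"

definition word_map :: "('v \<Rightarrow> 'v) list \<Rightarrow> 'v \<Rightarrow> 'v" where
  "word_map s = foldr (\<circ>) s id"

definition synchronizing :: "('v \<Rightarrow> 'v) pmf \<Rightarrow> bool" where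
  "synchronizing \<mu> \<longleftrightarrow> (\<exists>s x. word \<mu> s \<and> range (word_map s) = {x})"

definition synchronizing_set :: "('v \<Rightarrow> 'v) pmf \<Rightarrow> 'v set \<Rightarrow> bool" where
  "synchronizing_set \<mu> V\<^sub>0 \<longleftrightarrow> (\<exists>s x. word \<mu> s \<and> word_map s ` V\<^sub>0 = {x})"

definition deadlock :: "('v \<Rightarrow> 'v) pmf \<Rightarrow> 'v set \<Rightarrow> bool" where
  "deadlock \<mu> V\<^sub>0 \<longleftrightarrow> (\<forall>x\<in>V\<^sub>0. \<forall>y\<in>V\<^sub>0. x \<noteq> y \<longrightarrow> \<not> synchronizing_set \<mu> {x, y})"

definition F_clique :: "('v \<Rightarrow> 'v) pmf \<Rightarrow> 'v set \<Rightarrow> bool" where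
  "F_clique \<mu> V\<^sub>0 \<longleftrightarrow> deadlock \<mu> V\<^sub>0 \<and> (\<exists>s. word \<mu> s \<and> V\<^sub>0 = range (word_map s))"

definition min_image_card :: "('v::finite \<Rightarrow> 'v) pmf \<Rightarrow> nat" where
  "min_image_card \<mu> = Min {card (range (word_map s)) | s. word \<mu> s}"

end

theory Submission
  imports Defs
begin

text \<open>
  Call a set synchronizable if some word maps it to a single point, and let \<open>K\<close> be a synchronizable
  set of maximal \<open>\<lambda>\<close>-weight. Preimages of synchronizable sets are synchronizable, and by stationarity
  the weight of \<open>K\<close> is the \<open>\<mu>\<close>-average of the weights of its preimages, so every preimage
  of \<open>K\<close> under a word again has maximal weight. A deadlock meets a synchronizable set in at most
  one point; by strong connectedness each fibre of the word map onto the F-clique is therefore a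
  preimage of \<open>K\<close> under a suitable word. Thus all fibres have the same weight.
\<close>

lemma word_map_Nil [simp]: "word_map [] = id"
  and word_map_Cons [simp]: "word_map (\<sigma> # s) = \<sigma> \<circ> word_map s"
  by (simp_all add: word_map_def)

lemma word_map_append: "word_map (s @ t) = word_map s \<circ> word_map t"
  by (induction s) auto

lemma word_Nil [simp]: "word \<mu> []"
  and word_Cons [simp]: "word \<mu> (\<sigma> # s) \<longleftrightarrow> \<sigma> \<in> set_pmf \<mu> \<and> word \<mu> s"
  and word_append [simp]: "word \<mu> (s @ t) \<longleftrightarrow> word \<mu> s \<and> word \<mu> t"
  by (auto simp: word_def)

text \<open>A positive entry of a matrix product has a nonzero summand, which supplies a midpoint
  \<open>z\<close> and a last edge from \<open>z\<close> to \<open>y\<close>; the map labelling that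
  edge is put in front of the word. This turns strong connectedness into reachability by
  words.\<close>

lemma matrix_pow_adj_word:
  assumes "matrix_pow (adj \<mu>) n $ y $ x \<ge> 1"
  shows "\<exists>s. word \<mu> s \<and> word_map s x = y"
  using assms
proof (induction n arbitrary: y)
  case 0
  then have "x = y"
    by (auto simp: mat_def split: if_splits)
  then show ?case
    by (intro exI[of _ "[]"]) simp
next
  case (Suc n)
  then have "(\<Sum>z\<in>UNIV. adj \<mu> $ y $ z * matrix_pow (adj \<mu>) n $ z $ x) \<noteq> 0"
    by (simp add: matrix_matrix_mult_def del: sum_eq_0_iff)
  then obtain z where "adj \<mu> $ y $ z * matrix_pow (adj \<mu>) n $ z $ x \<noteq> 0"
    by (rule sum.not_neutral_contains_not_neutral)
  then have z: "adj \<mu> $ y $ z \<noteq> 0" "matrix_pow (adj \<mu>) n $ z $ x \<noteq> 0"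
    by simp_all
  from z(1) have "card {\<sigma> \<in> set_pmf \<mu>. \<sigma> z = y} \<noteq> 0"
    by (simp add: adj_def del: card_eq_0_iff)
  then obtain \<sigma> where "\<sigma> \<in> set_pmf \<mu>" "\<sigma> z = y"
    by (metis (mono_tags, lifting) card.empty empty_Collect_eq)
  moreover from Suc.IH[of z] z(2) obtain s where "word \<mu> s" "word_map s x = z"
    by auto
  ultimately show ?case
    by (intro exI[of _ "\<sigma> # s"]) simp
qed

text \<open>
  Unlike \<^const>\<open>synchronizing_set\<close>, this includes the empty set, so that it is closed under
  arbitrary preimages.
\<close>

definition synchronizable :: "('v \<Rightarrow> 'v) pmf \<Rightarrow> 'v set \<Rightarrow> bool" where
  "synchronizable \<mu> K \<longleftrightarrow> (\<exists>s x. word \<mu> s \<and> word_map s ` K \<subseteq> {x})"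

lemma synchronizable_vimage:
  assumes "synchronizable \<mu> K" "word \<mu> s"
  shows "synchronizable \<mu> (word_map s -` K)"
proof -
  from assms(1) obtain t x where "word \<mu> t" "word_map t ` K \<subseteq> {x}"
    by (auto simp: synchronizable_def)
  then show ?thesis
    unfolding synchronizable_def using assms(2)
    by (intro exI[of _ "t @ s"] exI[of _ x]) (auto simp: word_map_append)
qed

lemma synchronizable_singleton: "synchronizable \<mu> {x}"
  unfolding synchronizable_def by (intro exI[of _ "[]"] exI[of _ x]) simp

lemma deadlock_synchronizable_eq:
  assumes "deadlock \<mu> F" "synchronizable \<mu> K" "x \<in> F \<inter> K" "y \<in> F \<inter> K"
  shows "x = y"
proof (rule ccontr)
  assume "x \<noteq> y"
  from assms(2) obtain t z where "word \<mu> t" "word_map t ` K \<subseteq> {z}"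
    by (auto simp: synchronizable_def)
  with assms(3,4) have "word_map t ` {x, y} = {z}"
    by auto
  with \<open>word \<mu> t\<close> have "synchronizing_set \<mu> {x, y}"
    unfolding synchronizing_set_def by blast
  with assms(1,3,4) \<open>x \<noteq> y\<close> show False
    by (auto simp: deadlock_def)
qed

text \<open>Split according to the value of \<open>N k\<close>, which is independent of
  \<open>X (k - 1)\<close>. The splitting holds only up to a null set, because the recursion does.
  Once the marginals agree, this is the invariance of their law under \<open>\<mu>\<close>.\<close>

lemma (in random_walk) prob_step:
  "prob (X k -` B \<inter> space M) =
    (\<Sum>\<sigma>\<in>UNIV. pmf \<mu> \<sigma> * prob (X (k - 1) -` (\<sigma> -` B) \<inter> space M))"
proof -
  have X_sets: "X j -` C \<inter> space M \<in> sets M" for j C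
    using X_measurable by (rule measurable_sets) simp
  have N_sets: "N j -` C \<inter> space M \<in> sets M" for j C
    using N_measurable by (rule measurable_sets) simp
  let ?E = "\<lambda>\<sigma>. (N k -` {\<sigma>} \<inter> space M) \<inter> (X (k - 1) -` (\<sigma> -` B) \<inter> space M)"
  have "prob (X k -` B \<inter> space M) = prob (\<Union>\<sigma>\<in>UNIV. ?E \<sigma>)"
  proof (rule finite_measure_eq_AE)
    show "AE \<omega> in M. \<omega> \<in> X k -` B \<inter> space M \<longleftrightarrow> \<omega> \<in> (\<Union>\<sigma>\<in>UNIV. ?E \<sigma>)"
      using step[of k] by eventually_elim auto
    show "(\<Union>\<sigma>\<in>UNIV. ?E \<sigma>) \<in> events"
      using X_sets N_sets by (intro sets.finite_UN) auto
  qed (rule X_sets)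
  also have "\<dots> = (\<Sum>\<sigma>\<in>UNIV. prob (?E \<sigma>))"
    using X_sets N_sets
    by (intro finite_measure_finite_Union) (auto simp: disjoint_family_on_def)
  also have "\<dots> = (\<Sum>\<sigma>\<in>UNIV. pmf \<mu> \<sigma> * prob (X (k - 1) -` (\<sigma> -` B) \<inter> space M))"
  proof (rule sum.cong[OF refl])
    fix \<sigma>
    have "prob (?E \<sigma>) =
        prob (N k -` {\<sigma>} \<inter> space M) * prob (X (k - 1) -` (\<sigma> -` B) \<inter> space M)"
      \<comment> \<open>The second event is a generator of the past, namely the one with
        \<open>j = k - 1\<close>.\<close>
      by (rule indep_setD[OF N_indep_past[of k]]) (auto intro!: sigma_sets.Basic)
    also have "prob (N k -` {\<sigma>} \<inter> space M) = measure (distr M (count_space UNIV) (N k)) {\<sigma>}"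
      by (rule measure_distr[symmetric]) (auto intro: N_measurable)
    also have "\<dots> = pmf \<mu> \<sigma>"
      by (simp add: N_law measure_pmf_single)
    finally show "prob (?E \<sigma>) = pmf \<mu> \<sigma> * prob (X (k - 1) -` (\<sigma> -` B) \<inter> space M)" .
  qed
  finally show ?thesis .
qed

text \<open>An average of numbers at most \<open>w\<close> equals \<open>w\<close> only if each
  number of positive weight is \<open>w\<close>. The induction varies \<open>K\<close> because the
  head of the word acts last, so its preimage is taken first.\<close>

lemma stationary_maximal_vimage:
  fixes \<mu> :: "('v::finite \<Rightarrow> 'v) pmf"
  assumes stat: "\<And>B. measure_pmf.prob lam B =
      (\<Sum>\<sigma>\<in>UNIV. pmf \<mu> \<sigma> * measure_pmf.prob lam (\<sigma> -` B))"
    and max: "\<And>B. synchronizable \<mu> B \<Longrightarrow> measure_pmf.prob lam B \<le> w"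
    and "synchronizable \<mu> K" "measure_pmf.prob lam K = w" "word \<mu> s"
  shows "measure_pmf.prob lam (word_map s -` K) = w"
  using assms(3-5)
proof (induction s arbitrary: K)
  case Nil
  then show ?case
    by simp
next
  case (Cons \<tau> s)
  then have \<tau>: "\<tau> \<in> set_pmf \<mu>" and s: "word \<mu> s"
    by simp_all
  have sync: "synchronizable \<mu> (\<sigma> -` K)" if "\<sigma> \<in> set_pmf \<mu>" for \<sigma>
    using synchronizable_vimage[OF Cons.prems(1), of "[\<sigma>]"] that by simp
  let ?d = "\<lambda>\<sigma>. pmf \<mu> \<sigma> * (w - measure_pmf.prob lam (\<sigma> -` K))"
  have "sum ?d UNIV = w * (\<Sum>\<sigma>\<in>UNIV. pmf \<mu> \<sigma>) - measure_pmf.prob lam K"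
    by (simp add: right_diff_distrib sum_subtractf sum_distrib_left mult.commute stat[of K])
  also have "\<dots> = 0"
    using Cons.prems(2) by (simp add: sum_pmf_eq_1)
  finally have "sum ?d UNIV = 0" .
  \<comment> \<open>Off the support the factor \<open>pmf \<mu> \<sigma>\<close> is 0, so no bound
    on the preimage is needed there.\<close>
  moreover have "?d \<sigma> \<ge> 0" for \<sigma>
    using max[OF sync, of \<sigma>] by (cases "\<sigma> \<in> set_pmf \<mu>") (auto simp: set_pmf_iff)
  ultimately have "?d \<tau> = 0"
    by (simp add: sum_nonneg_eq_0_iff)
  with \<tau> have "measure_pmf.prob lam (\<tau> -` K) = w"
    by (simp add: set_pmf_iff)
  from Cons.IH[OF sync[OF \<tau>] this s] show ?case
    by (simp add: vimage_def)
qed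

theorem theorem4p1:
  fixes \<mu> :: "('v::finite \<Rightarrow> 'v) pmf"
    and M :: "'w measure"
    and X :: "int \<Rightarrow> 'w \<Rightarrow> 'v"
    and N :: "int \<Rightarrow> 'w \<Rightarrow> ('v \<Rightarrow> 'v)"
    and lam :: "'v pmf"
    and s :: "('v \<Rightarrow> 'v) list"
    and xhat :: "nat \<Rightarrow> 'v"
    and mhat :: nat
    and V :: "nat \<Rightarrow> 'v set"
  assumes "constant_outdegree (adj \<mu>)"
    and "strongly_connected (adj \<mu>)"
    and "aperiodic (adj \<mu>)"
    and "random_walk \<mu> M X N"
    and common_law: "\<And>k. distr M (count_space UNIV) (X k) = measure_pmf lam"
    and "\<not> synchronizing \<mu>"
    and "word \<mu> s"
    and "F_clique \<mu> (range (word_map s))"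
    and mhat: "mhat = min_image_card \<mu>"
    and xhat: "bij_betw xhat {1..mhat} (range (word_map s))"
    and V: "\<And>i. i \<in> {1..mhat} \<Longrightarrow> V i = {x. word_map s x = xhat i}"
  shows "\<forall>i\<in>{1..mhat}. measure_pmf.prob lam (V i) = 1 / real mhat"
proof -
  interpret random_walk \<mu> M X N
    by (rule assms(4))
  let ?P = "measure_pmf.prob lam"
  let ?F = "range (word_map s)"
  have lam_X: "?P B = prob (X k -` B \<inter> space M)" for B k
    unfolding common_law[of k, symmetric]
    by (rule measure_distr) (auto intro: X_measurable)
  have stat: "?P B = (\<Sum>\<sigma>\<in>UNIV. pmf \<mu> \<sigma> * ?P (\<sigma> -` B))" for B
    \<comment> \<open>The time 0 is arbitrary: the marginals at 0 and -1 are both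
      \<open>lam\<close>.\<close>
    using prob_step[of 0 B] by (simp add: lam_X[of _ 0, symmetric] lam_X[of _ "-1", symmetric])
  have reach: "\<exists>u. word \<mu> u \<and> word_map u x = y" for x y
    using assms(2) matrix_pow_adj_word unfolding strongly_connected_def by blast
  have deadlock: "deadlock \<mu> ?F"
    using assms(8) by (simp add: F_clique_def)

  define w where "w = Max (?P ` Collect (synchronizable \<mu>))"
  have max: "?P B \<le> w" if "synchronizable \<mu> B" for B
    unfolding w_def using that by (intro Max_ge) auto
  have "w \<in> ?P ` Collect (synchronizable \<mu>)"
    unfolding w_def using synchronizable_singleton[of \<mu>] by (intro Max_in) (simp, blast)
  then obtain K where K: "synchronizable \<mu> K" "?P K = w"
    by auto
  \<comment> \<open>A singleton of positive mass forces \<open>w > 0\<close>, so \<open>K\<close> is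
    nonempty and offers a target point \<open>k\<close>.\<close>
  obtain x where "x \<in> set_pmf lam"
    using set_pmf_not_empty[of lam] by blast
  then have "w > 0"
    using max[OF synchronizable_singleton, of x] pmf_positive[of x lam]
    by (simp add: measure_pmf_single)
  with K(2) obtain k where "k \<in> K"
    by force

  have fibre: "?P (word_map s -` {x}) = w" if x: "x \<in> ?F" for x
  proof -
    \<comment> \<open>Since \<open>u\<close> sends \<open>x\<close> into \<open>K\<close>, the
      preimage of \<open>K\<close> under \<open>u\<close> meets the deadlock \<open>?F\<close> in
      \<open>x\<close> alone; pulling back along \<open>s\<close> gives exactly the fibre over
      \<open>x\<close>.\<close>
    obtain u where u: "word \<mu> u" "word_map u x = k"
      using reach by blast
    have "synchronizable \<mu> (word_map u -` K)"
      using K(1) u(1) by (rule synchronizable_vimage)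
    then have "word_map s y = x" if "word_map u (word_map s y) \<in> K" for y
    proof (rule deadlock_synchronizable_eq[OF deadlock])
      show "word_map s y \<in> ?F \<inter> word_map u -` K" "x \<in> ?F \<inter> word_map u -` K"
        using that x u(2) \<open>k \<in> K\<close> by simp_all
    qed
    with u(2) \<open>k \<in> K\<close> have "word_map u (word_map s y) \<in> K \<longleftrightarrow> word_map s y = x" for y
      by metis
    then have "word_map (u @ s) -` K = word_map s -` {x}"
      by (simp add: word_map_append vimage_def)
    moreover have "?P (word_map (u @ s) -` K) = w"
      by (rule stationary_maximal_vimage[OF stat max K]) (simp_all add: u(1) assms(7))
    ultimately show ?thesis
      by simp
  qed

  have card: "card ?F = mhat"
    using bij_betw_same_card[OF xhat] by simp
  have "(\<Union>x\<in>?F. word_map s -` {x}) = UNIV"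
    by auto
  then have "1 = ?P (\<Union>x\<in>?F. word_map s -` {x})"
    by simp
  also have "\<dots> = (\<Sum>x\<in>?F. ?P (word_map s -` {x}))"
    by (rule measure_pmf.finite_measure_finite_Union) (auto simp: disjoint_family_on_def)
  also have "\<dots> = mhat * w"
    by (simp add: fibre card)
  finally have "w = 1 / mhat"
    \<comment> \<open>For \<open>mhat = 0\<close> the equation would read 1 = 0.\<close>
    by (cases "mhat = 0") (simp_all add: field_simps)
  moreover have "V i = word_map s -` {xhat i}" if "i \<in> {1..mhat}" for i
    using V[OF that] by auto
  moreover have "xhat i \<in> ?F" if "i \<in> {1..mhat}" for i
    using bij_betwE[OF xhat] that by blast
  ultimately show ?thesis
    using fibre by simp
qed

end
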